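(* Let $n \ge 2$. In No-more-than-half-delete Nim with $n$ heaps, the position $\langle z_1, z_2, \ldots, z_n \rangle$ (with $z_1,\ldots,z_n$ positive integers) is a $\mathcal{P}$-position if and only if: (i) when $n$ is even, $v_2(z_1)=v_2(z_2)=\cdots=v_2(z_n)=0$ (i.e., every $z_i$ is odd); (ii) when $n$ is odd, $v_2(z_1)=v_2(z_2)=\cdots=v_2(z_n)$.
   Context: For a positive integer $z$, $v_2(z)$ denotes the $2$-adic valuation of $z$, i.e., the exponent of the largest power of $2$ dividing $z$. No-more-than-half-delete Nim with $n$ heaps: a position is an $n$-tuple $\langle z_1,\ldots,z_n\rangle$ of positive integers (heap sizes). Two players alternate moves. A move consists of choosing a positive integer $k \le n/2$, selecting $k$ heaps and deleting them, and then selecting $k$ of the remaining $n-k$ heaps and splitting each of them into two heaps, each containing at least one token (so the number of heaps stays $n$). Normal play convention: a player who cannot move loses. A $\mathcal{P}$-position is a position from which the player about to move has no winning strategy. *)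

theory Defs
  imports "HOL-Library.Multiset" "HOL-Computational_Algebra.Primes"
begin

text \<open>
  A move from \<open>zs\<close>: \<open>D\<close> are the deleted heaps, the pairs \<open>(a, b)\<close> in \<open>S\<close> are the splits (a heap of
  size \<open>a + b\<close> becomes heaps of sizes \<open>a\<close> and \<open>b\<close>), and \<open>R\<close> are the untouched heaps. The order in
  which the resulting heaps are listed is immaterial, so every ordering of them is an option.
\<close>

definition half_delete_move :: "nat list \<Rightarrow> nat list \<Rightarrow> bool" where
  "half_delete_move zs zs' \<longleftrightarrow>
     (\<exists>k D S R. 0 < k \<and> 2 * k \<le> length zs \<and> size D = k \<and> size S = k \<and>
        (\<forall>(a, b) \<in># S. 0 < a \<and> 0 < b) \<and>
        mset zs = D + image_mset (\<lambda>(a, b). a + b) S + R \<and>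
        mset zs' = R + image_mset fst S + image_mset snd S)"

text \<open>
  A finite play is the list of positions visited so far. The player about to move at the initial
  position moves exactly after the plays of odd length. A strategy maps the play so far to the next
  position.
\<close>

definition play_from :: "('p \<Rightarrow> 'p \<Rightarrow> bool) \<Rightarrow> 'p \<Rightarrow> 'p list \<Rightarrow> bool" where
  "play_from move p ps \<longleftrightarrow> ps \<noteq> [] \<and> hd ps = p \<and> successively move ps"

definition follows :: "('p list \<Rightarrow> 'p) \<Rightarrow> 'p list \<Rightarrow> bool" where
  "follows \<sigma> ps \<longleftrightarrow> (\<forall>i. even i \<and> Suc i < length ps \<longrightarrow> ps ! Suc i = \<sigma> (take (Suc i) ps))"

text \<open>
  Normal play: a strategy wins if the player following it always has the legal move it prescribes.
  This is adequate for games without infinite plays, where then the opponent is the one who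
  eventually cannot move; see \<open>half_delete_move_sum_less\<close> below.
\<close>

definition winning_strategy :: "('p \<Rightarrow> 'p \<Rightarrow> bool) \<Rightarrow> 'p \<Rightarrow> ('p list \<Rightarrow> 'p) \<Rightarrow> bool" where
  "winning_strategy move p \<sigma> \<longleftrightarrow>
     (\<forall>ps. play_from move p ps \<and> follows \<sigma> ps \<and> odd (length ps) \<longrightarrow> move (last ps) (\<sigma> ps))"

definition P_position :: "('p \<Rightarrow> 'p \<Rightarrow> bool) \<Rightarrow> 'p \<Rightarrow> bool" where
  "P_position move p \<longleftrightarrow> (\<nexists>\<sigma>. winning_strategy move p \<sigma>)"

lemma half_delete_move_length:
  assumes "half_delete_move zs zs'"
  shows "length zs' = length zs"
proof -
  obtain D R :: "nat multiset" and S :: "(nat \<times> nat) multiset" where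
    *: "size D = size S" "mset zs = D + image_mset (\<lambda>(a, b). a + b) S + R"
      "mset zs' = R + image_mset fst S + image_mset snd S"
    using assms unfolding half_delete_move_def by metis
  have "size (mset zs') = size (mset zs)"
    unfolding *(2,3) using *(1) by simp
  then show ?thesis by simp
qed

lemma half_delete_move_pos:
  assumes "half_delete_move zs zs'" and "\<forall>z\<in>set zs. 0 < z"
  shows "\<forall>z\<in>set zs'. 0 < z"
proof -
  obtain D R :: "nat multiset" and S :: "(nat \<times> nat) multiset" where
    *: "\<forall>(a, b) \<in># S. 0 < a \<and> 0 < b" "mset zs = D + image_mset (\<lambda>(a, b). a + b) S + R"
      "mset zs' = R + image_mset fst S + image_mset snd S"
    using assms(1) unfolding half_delete_move_def by metis
  have "set_mset R \<subseteq> set zs"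
    unfolding set_mset_mset[symmetric] *(2) by auto
  moreover have "set zs' = set_mset R \<union> fst ` set_mset S \<union> snd ` set_mset S"
    unfolding set_mset_mset[symmetric] *(3) by simp
  ultimately show ?thesis using *(1) assms(2) by auto
qed

lemma half_delete_move_sum_less:
  assumes "half_delete_move zs zs'" and "\<forall>z\<in>set zs. 0 < z"
  shows "sum_list zs' < sum_list zs"
proof -
  obtain D R :: "nat multiset" and S :: "(nat \<times> nat) multiset" where
    *: "0 < size D" "mset zs = D + image_mset (\<lambda>(a, b). a + b) S + R"
      "mset zs' = R + image_mset fst S + image_mset snd S"
    using assms(1) unfolding half_delete_move_def by metis
  have split: "sum_mset (image_mset (\<lambda>(a, b). a + b) S)
      = sum_mset (image_mset fst S) + sum_mset (image_mset snd S)"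
    by (induction S) auto
  obtain d where d: "d \<in># D" using *(1) by fastforce
  have "d \<in> set zs"
    unfolding set_mset_mset[symmetric] *(2) using d by simp
  then have "0 < sum_mset D" using d assms(2) by (auto dest!: multi_member_split)
  then have "sum_mset (mset zs') < sum_mset (mset zs)"
    unfolding *(2,3) using split by simp
  then show ?thesis by (simp add: sum_mset_sum_list)
qed

end

theory Submission
  imports Defs
begin

text \<open>
  Call a position uniform if all its heaps have the same valuation \<open>m\<close>, where \<open>m = 0\<close> is required
  for even \<open>n\<close>. If \<open>a\<close> and \<open>b\<close> have the same valuation, then \<open>a + b\<close> has a larger one, so a move
  between uniform positions would have to lower \<open>m\<close>; but \<open>m = 0\<close> cannot be lowered, and for odd
  \<open>n\<close> some heap stays untouched. Conversely, a heap \<open>z\<close> of valuation larger than \<open>m\<close> splits into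
  \<open>2 ^ m\<close> and \<open>z - 2 ^ m\<close>, both of valuation \<open>m\<close>. From a non-uniform position one takes \<open>m\<close> minimal
  (or \<open>0\<close> for even \<open>n\<close>), splits half of the \<open>e\<close> heaps of larger valuation, rounding up, and deletes
  the other half, together with one heap of valuation \<open>m\<close> if \<open>e\<close> is odd.
\<close>

section \<open>Strategies and kernels of games\<close>

text \<open>The strategy always moves into \<open>Q\<close> and the opponent has to leave
  \<open>Q\<close> again, so at each own turn the position is outside \<open>Q\<close> and
  \<open>enters\<close> supplies a legal move.\<close>

lemma winning_strategy_into_kernel:
  assumes "I p" "\<not> Q p"
    and inv: "\<And>p q. I p \<Longrightarrow> move p q \<Longrightarrow> I q"
    and exits: "\<And>p q. I p \<Longrightarrow> Q p \<Longrightarrow> move p q \<Longrightarrow> \<not> Q q"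
    and enters: "\<And>p. I p \<Longrightarrow> \<not> Q p \<Longrightarrow> \<exists>q. move p q \<and> Q q"
  shows "winning_strategy move p (\<lambda>ps. SOME q. move (last ps) q \<and> Q q)"
proof -
  let ?s = "\<lambda>ps. SOME q. move (last ps) q \<and> Q q"
  have s: "move (last ps) (?s ps) \<and> Q (?s ps)" if "I (last ps)" "\<not> Q (last ps)" for ps
    using enters[OF that] by (rule someI_ex)
  have "I (last ps) \<and> \<not> Q (last ps)"
    if "play_from move p ps" "follows ?s ps" "odd (length ps)" for ps
    using that
  proof (induction "length ps" arbitrary: ps rule: less_induct)
    case less
    show ?case
    proof (cases "length ps = 1")
      case True
      then have "ps = [p]"
        using less.prems(1) by (auto simp: play_from_def length_Suc_conv)
      then show ?thesis using assms(1,2) by simp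
    next
      case False
      obtain ps' r where ps': "ps = ps' @ [r]"
        using less.prems(3) by (cases ps rule: rev_cases) auto
      \<comment> \<open>A longer play ends in one full round: the strategy moves to
        \<open>q\<close>, the opponent answers with \<open>r\<close>. The induction hypothesis
        applies to the play \<open>qs\<close> before that round.\<close>
      obtain qs q where "ps' = qs @ [q]"
        using False ps' by (cases ps' rule: rev_cases) auto
      then have ps: "ps = qs @ [q, r]" by (simp add: ps')
      then have "qs \<noteq> []" using less.prems(3) by auto
      have qs: "play_from move p qs" and m: "move (last qs) q" "move q r"
        using less.prems(1) \<open>qs \<noteq> []\<close>
        by (auto simp: play_from_def ps successively_append_iff)
      have "follows ?s qs"
        unfolding follows_def
      proof (intro allI impI)
        fix i assume i: "even i \<and> Suc i < length qs"
        then have "ps ! Suc i = ?s (take (Suc i) ps)"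
          using less.prems(2) unfolding follows_def ps by simp
        then show "qs ! Suc i = ?s (take (Suc i) qs)"
          using i by (simp add: ps nth_append)
      qed
      moreover have "odd (length qs)" using less.prems(3) ps by simp
      ultimately have IH: "I (last qs)" "\<not> Q (last qs)"
        using less.hyps[of qs] qs ps by auto
      have "even (length qs - 1) \<and> Suc (length qs - 1) = length qs"
        using \<open>odd (length qs)\<close> \<open>qs \<noteq> []\<close> by simp
      then have "ps ! length qs = ?s (take (length qs) ps)"
        using less.prems(2) unfolding follows_def ps
        by (metis length_append length_Cons less_add_same_cancel1 zero_less_Suc)
      then have "q = ?s qs" by (simp add: ps)
      then have "Q q" using s[OF IH] by simp
      have "I q" using inv[OF IH(1) m(1)] .
      then show ?thesis using inv[OF _ m(2)] exits[OF _ \<open>Q q\<close> m(2)] by (simp add: ps)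
    qed
  qed
  then show ?thesis unfolding winning_strategy_def using s by blast
qed

lemma winning_strategy_first_move:
  assumes "winning_strategy move p \<sigma>"
  shows "move p (\<sigma> [p])"
proof -
  have "play_from move p [p]" "follows \<sigma> [p]"
    by (simp_all add: play_from_def follows_def)
  then show ?thesis using assms unfolding winning_strategy_def by fastforce
qed

text \<open>Putting the first round \<open>p\<close>, \<open>\<sigma> [p]\<close> in front of a play
  from \<open>r\<close> gives a play from \<open>p\<close>. Two added positions keep the parity of
  the length, hence the turns agree.\<close>

lemma winning_strategy_after_reply:
  assumes win: "winning_strategy move p \<sigma>" and reply: "move (\<sigma> [p]) r"
  shows "winning_strategy move r (\<lambda>ps. \<sigma> (p # \<sigma> [p] # ps))"
  unfolding winning_strategy_def
proof (intro allI impI, elim conjE)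
  fix ps
  assume ps: "play_from move r ps" "follows (\<lambda>ps. \<sigma> (p # \<sigma> [p] # ps)) ps" "odd (length ps)"
  let ?ps = "p # \<sigma> [p] # ps"
  have "play_from move p ?ps"
    using ps(1) reply winning_strategy_first_move[OF win]
    by (cases ps) (auto simp: play_from_def)
  moreover have "follows \<sigma> ?ps"
    unfolding follows_def
  proof (intro allI impI)
    fix i assume i: "even i \<and> Suc i < length ?ps"
    show "?ps ! Suc i = \<sigma> (take (Suc i) ?ps)"
    proof (cases "i = 0")
      case False
      then obtain j where j: "i = Suc (Suc j)" using i by (metis even_Suc not0_implies_Suc even_zero)
      then show ?thesis using ps(2) i unfolding follows_def by auto
    qed simp
  qed
  ultimately have "move (last ?ps) (\<sigma> ?ps)"
    using win ps(3) unfolding winning_strategy_def by (metis even_Suc length_Cons)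
  then show "move (last ps) (\<sigma> ?ps)" using ps(1) by (simp add: play_from_def)
qed

text \<open>Descent on \<open>f\<close>: the first move of a supposed winning strategy leaves
  \<open>Q\<close>, the opponent returns to \<open>Q\<close> at some \<open>r\<close>, and the rest
  of the strategy would win from \<open>r\<close>. It is a new strategy, so the induction
  generalises \<open>\<sigma>\<close>.\<close>

lemma no_winning_strategy_from_kernel:
  fixes f :: "'p \<Rightarrow> nat"
  assumes "I p" "Q p"
    and inv: "\<And>p q. I p \<Longrightarrow> move p q \<Longrightarrow> I q"
    and dec: "\<And>p q. I p \<Longrightarrow> move p q \<Longrightarrow> f q < f p"
    and exits: "\<And>p q. I p \<Longrightarrow> Q p \<Longrightarrow> move p q \<Longrightarrow> \<not> Q q"
    and enters: "\<And>p. I p \<Longrightarrow> \<not> Q p \<Longrightarrow> \<exists>q. move p q \<and> Q q"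
  shows "\<not> winning_strategy move p \<sigma>"
  using assms(1,2)
proof (induction "f p" arbitrary: p \<sigma> rule: less_induct)
  case less
  show ?case
  proof
    assume win: "winning_strategy move p \<sigma>"
    note first = winning_strategy_first_move[OF win]
    have I: "I (\<sigma> [p])" using inv less.prems first by blast
    obtain r where r: "move (\<sigma> [p]) r" "Q r"
      using enters[OF I] exits[OF less.prems first] by blast
    have "f r < f p" using dec[OF less.prems(1) first] dec[OF I r(1)] by simp
    then show False
      using less.hyps[OF _ inv[OF I r(1)] r(2)] winning_strategy_after_reply[OF win r(1)] by blast
  qed
qed

lemma P_position_iff_kernel:
  fixes f :: "'p \<Rightarrow> nat"
  assumes "I p"
    and "\<And>p q. I p \<Longrightarrow> move p q \<Longrightarrow> I q"
    and "\<And>p q. I p \<Longrightarrow> move p q \<Longrightarrow> f q < f p"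
    and "\<And>p q. I p \<Longrightarrow> Q p \<Longrightarrow> move p q \<Longrightarrow> \<not> Q q"
    and "\<And>p. I p \<Longrightarrow> \<not> Q p \<Longrightarrow> \<exists>q. move p q \<and> Q q"
  shows "P_position move p \<longleftrightarrow> Q p"
proof
  assume "P_position move p"
  then show "Q p"
    using winning_strategy_into_kernel[of I p Q move] assms unfolding P_position_def by blast
next
  assume "Q p"
  then show "P_position move p"
    using no_winning_strategy_from_kernel[of I p Q move f] assms unfolding P_position_def by blast
qed

section \<open>2-adic valuations of sums and differences\<close>

text \<open>Dividing by \<open>2 ^ m\<close> leaves a sum of two odd numbers, which is even.\<close>

lemma multiplicity_two_add_less:
  fixes a b :: nat
  assumes "0 < a" "0 < b" "multiplicity 2 a = m" "multiplicity 2 b = m"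
  shows "m < multiplicity 2 (a + b)"
proof -
  obtain a' where a: "a = 2 ^ m * a'" "odd a'"
    using multiplicity_decompose'[of a 2] assms by auto
  obtain b' where b: "b = 2 ^ m * b'" "odd b'"
    using multiplicity_decompose'[of b 2] assms by auto
  obtain c where "a' + b' = 2 * c" using a b by (metis dvd_def odd_even_add)
  then have "a + b = 2 ^ Suc m * c" using a b by (simp add: distrib_left[symmetric])
  then have "2 ^ Suc m dvd a + b" by simp
  then have "Suc m \<le> multiplicity 2 (a + b)"
    using assms by (intro multiplicity_geI) auto
  then show ?thesis by simp
qed

text \<open>Writing \<open>z = 2 ^ Suc m * c\<close> with \<open>c\<close> positive, the difference
  is \<open>2 ^ m\<close> times the odd number \<open>2 * c - 1\<close>.\<close>

lemma multiplicity_two_diff_power: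
  fixes z :: nat
  assumes "0 < z" "m < multiplicity 2 z"
  shows "2 ^ m < z" "multiplicity 2 (z - 2 ^ m) = m"
proof -
  have "2 ^ Suc m dvd z" using assms(2) by (intro multiplicity_dvd') simp
  then obtain c where z: "z = 2 ^ Suc m * c" by auto
  then have "0 < c" using assms(1) by simp
  then show "2 ^ m < z" by (simp add: z)
  have "z - 2 ^ m = 2 ^ m * (2 * c - 1)" by (simp add: z right_diff_distrib')
  moreover have "odd (2 * c - 1)" using \<open>0 < c\<close> by simp
  ultimately show "multiplicity 2 (z - 2 ^ m) = m" by (intro multiplicity_eqI) auto
qed

section \<open>Moves out of and into uniform positions\<close>

definition uniform :: "nat list \<Rightarrow> bool" where
  "uniform zs \<longleftrightarrow>
     (\<exists>m. (even (length zs) \<longrightarrow> m = 0) \<and> (\<forall>z\<in>set zs. multiplicity 2 z = m))"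

lemma move_from_uniform:
  assumes move: "half_delete_move zs zs'" and "uniform zs"
  shows "\<not> uniform zs'"
proof
  assume "uniform zs'"
  obtain D R :: "nat multiset" and S :: "(nat \<times> nat) multiset" where
    *: "0 < size S" "2 * size S \<le> length zs" "size D = size S"
      "\<forall>(a, b) \<in># S. 0 < a \<and> 0 < b" "mset zs = D + image_mset (\<lambda>(a, b). a + b) S + R"
      "mset zs' = R + image_mset fst S + image_mset snd S"
    using move unfolding half_delete_move_def by metis
  have zs: "set zs = set_mset D \<union> (\<lambda>(a, b). a + b) ` set_mset S \<union> set_mset R"
    unfolding set_mset_mset[symmetric] *(5) by simp
  have zs': "set zs' = set_mset R \<union> fst ` set_mset S \<union> snd ` set_mset S"
    unfolding set_mset_mset[symmetric] *(6) by simp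
  obtain m where m: "even (length zs) \<longrightarrow> m = 0" "\<forall>z\<in>set zs. multiplicity 2 z = m"
    using \<open>uniform zs\<close> unfolding uniform_def by blast
  obtain m' where m': "\<forall>z\<in>set zs'. multiplicity 2 z = m'"
    using \<open>uniform zs'\<close> unfolding uniform_def by blast
  have "S \<noteq> {#}" using *(1) by auto
  then obtain a b where ab: "(a, b) \<in># S" by (metis multiset_nonemptyE surj_pair)
  have "a + b \<in> set zs" "a \<in> set zs'" "b \<in> set zs'"
    unfolding zs zs' using ab by force+
  then have "multiplicity 2 (a + b) = m" "multiplicity 2 a = m'" "multiplicity 2 b = m'"
    using m(2) m' by blast+
  moreover have "0 < a" "0 < b" using *(4) ab by auto
  ultimately have "m' < m" using multiplicity_two_add_less by blast
  then have "odd (length zs)" using m(1) by auto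
  \<comment> \<open>An odd number of heaps forces an untouched one; lying in both positions, it has
    valuation \<open>m\<close> and also \<open>m'\<close>.\<close>
  moreover have "length zs = 2 * size S + size R"
    using arg_cong[OF *(5), of size] *(3) by simp
  ultimately have "0 < size R" by (auto intro: Nat.gr0I)
  then obtain r where "r \<in># R" by fastforce
  then have "r \<in> set zs" "r \<in> set zs'" unfolding zs zs' by auto
  then show False using m(2) m' \<open>m' < m\<close> by auto
qed

lemma subset_mset_of_size:
  assumes "k \<le> size M"
  obtains N where "N \<subseteq># M" "size N = k"
proof -
  obtain xs where "M = mset xs" using ex_mset[of M] by auto
  moreover have "mset (take k xs) \<subseteq># mset xs"
    by (metis append_take_drop_id mset_append mset_subset_eq_add_left)
  ultimately show ?thesis using that[of "mset (take k xs)"] assms by simp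
qed

lemma move_to_multiplicity:
  fixes zs :: "nat list" and m :: nat
  defines "e \<equiv> size (filter_mset (\<lambda>z. m < multiplicity 2 z) (mset zs))"
  assumes pos: "\<forall>z\<in>set zs. 0 < z" and ge: "\<forall>z\<in>set zs. m \<le> multiplicity 2 z"
    and e: "0 < e" "2 * ((e + 1) div 2) \<le> length zs"
  obtains zs' where "half_delete_move zs zs'" "\<forall>z\<in>set zs'. multiplicity 2 z = m"
proof -
  define E where "E = filter_mset (\<lambda>z. m < multiplicity 2 z) (mset zs)"
  define F where "F = filter_mset (\<lambda>z. \<not> m < multiplicity 2 z) (mset zs)"
  define k where "k = (e + 1) div 2"
  have EF: "mset zs = E + F" unfolding E_def F_def by simp
  have size_E: "size E = e" by (simp add: E_def e_def)
  have size_EF: "length zs = e + size F" using arg_cong[OF EF, of size] size_E by simp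
  have k: "0 < k" "k \<le> e" "e \<le> 2 * k" "2 * k \<le> length zs" using e unfolding k_def by auto
  obtain T where T: "T \<subseteq># E" "size T = k"
    using subset_mset_of_size[of k E] k size_E by auto
  \<comment> \<open>\<open>G\<close> pads the \<open>e - k\<close> deleted heaps of
    \<open>E - T\<close> to exactly \<open>k\<close>; it is a single heap if \<open>e\<close> is odd
    and empty otherwise.\<close>
  obtain G where G: "G \<subseteq># F" "size G = 2 * k - e"
    using subset_mset_of_size[of "2 * k - e" F] k(4) size_EF by (metis add.commute le_diff_conv)
  define S where "S = image_mset (\<lambda>z. (2 ^ m :: nat, z - 2 ^ m)) T"
  have T_prop: "2 ^ m < z" "multiplicity 2 (z - 2 ^ m) = m" if "z \<in># T" for z
  proof -
    have "z \<in># E" using T(1) that by (rule mset_subset_eqD)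
    then have "0 < z" "m < multiplicity 2 z" using pos by (auto simp: E_def)
    then show "2 ^ m < z" "multiplicity 2 (z - 2 ^ m) = m"
      by (rule multiplicity_two_diff_power)+
  qed
  have "image_mset (\<lambda>(a, b). a + b) S = image_mset (\<lambda>z. z) T"
    unfolding S_def image_mset.compositionality
    by (rule image_mset_cong) (use T_prop(1) in \<open>force simp: less_imp_le\<close>)
  moreover have "E = (E - T) + T" "F = G + (F - G)" using T(1) G(1) by simp_all
  ultimately have zs: "mset zs = ((E - T) + G) + image_mset (\<lambda>(a, b). a + b) S + (F - G)"
    using EF by (metis add.assoc add.commute multiset.map_ident)
  obtain zs' where zs': "mset zs' = (F - G) + image_mset fst S + image_mset snd S"
    using ex_mset by blast
  have "size ((E - T) + G) = k"
    unfolding size_union using T G k size_E by (simp add: size_Diff_submset)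
  moreover have "size S = k" using T by (simp add: S_def)
  moreover have "\<forall>(a, b) \<in># S. 0 < a \<and> 0 < b" using T_prop(1) by (auto simp: S_def)
  ultimately have "half_delete_move zs zs'"
    unfolding half_delete_move_def using k(1,4) zs zs' by blast
  moreover have "multiplicity 2 z = m" if "z \<in> set zs'" for z
  proof -
    have "z \<in># F - G \<or> z = 2 ^ m \<or> (\<exists>t. t \<in># T \<and> z = t - 2 ^ m)"
      using that unfolding set_mset_mset[symmetric] zs' by (auto simp: S_def)
    moreover have "multiplicity 2 z = m" if "z \<in># F - G"
    proof -
      have "z \<in># F" using that by (rule in_diffD)
      then show ?thesis using ge by (auto simp: F_def)
    qed
    ultimately show ?thesis using T_prop(2) by auto
  qed
  ultimately show ?thesis using that by blast
qed

lemma move_into_uniform: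
  assumes pos: "\<forall>z\<in>set zs. 0 < z" and not: "\<not> uniform zs"
  shows "\<exists>zs'. half_delete_move zs zs' \<and> uniform zs'"
proof -
  have "zs \<noteq> []" using not by (auto simp: uniform_def)
  define m where "m = (if even (length zs) then 0 else Min (multiplicity 2 ` set zs))"
  define e where "e = size (filter_mset (\<lambda>z. m < multiplicity 2 z) (mset zs))"
  have ge: "\<forall>z\<in>set zs. m \<le> multiplicity 2 z" by (simp add: m_def)
  obtain z where "z \<in> set zs" "m < multiplicity 2 z"
  proof -
    have "even (length zs) \<longrightarrow> m = 0" by (simp add: m_def)
    then obtain z where "z \<in> set zs" "multiplicity 2 z \<noteq> m"
      using not unfolding uniform_def by blast
    then show ?thesis using that ge by (metis le_neq_implies_less)
  qed
  then have "z \<in># filter_mset (\<lambda>z. m < multiplicity 2 z) (mset zs)" by simp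
  then have "0 < e" unfolding e_def by (metis size_eq_0_iff_empty empty_iff set_mset_empty gr0I)
  have "e \<le> length zs" unfolding e_def by (metis size_filter_mset_lesseq size_mset)
  \<comment> \<open>The left side is \<open>e\<close> rounded up to an even number. For even length
    \<open>e \<le> length zs\<close> is enough; for odd length a heap attaining the minimum is not
    counted, so \<open>e < length zs\<close>.\<close>
  have "2 * ((e + 1) div 2) \<le> length zs"
  proof (cases "even (length zs)")
    case True
    then show ?thesis using \<open>e \<le> length zs\<close> by (auto elim!: evenE)
  next
    case False
    have "m \<in> multiplicity 2 ` set zs"
      using False \<open>zs \<noteq> []\<close> by (simp add: m_def)
    then obtain y where y: "y \<in> set zs" "multiplicity 2 y = m" by auto
    then have "y \<notin># filter_mset (\<lambda>z. m < multiplicity 2 z) (mset zs)" "y \<in># mset zs"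
      by auto
    then have "filter_mset (\<lambda>z. m < multiplicity 2 z) (mset zs) \<subset># mset zs"
      by (metis multiset_filter_subset subset_mset.le_neq_trans)
    then have "e < length zs" unfolding e_def by (metis mset_subset_size size_mset)
    then show ?thesis by linarith
  qed
  then obtain zs' where zs': "half_delete_move zs zs'" "\<forall>z\<in>set zs'. multiplicity 2 z = m"
    using move_to_multiplicity[OF pos ge] \<open>0 < e\<close> unfolding e_def by blast
  have "even (length zs') \<longrightarrow> m = 0"
    using half_delete_move_length[OF zs'(1)] by (simp add: m_def)
  then show ?thesis using zs' unfolding uniform_def by blast
qed

lemma P_position_iff_uniform:
  assumes "\<forall>z\<in>set zs. 0 < z"
  shows "P_position half_delete_move zs \<longleftrightarrow> uniform zs"
proof (rule P_position_iff_kernel[where I = "\<lambda>zs. \<forall>z\<in>set zs. 0 < z" and f = sum_list])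
  show "\<forall>z\<in>set zs. 0 < z" by (fact assms)
next
  fix ps qs :: "nat list"
  assume pos: "\<forall>z\<in>set ps. 0 < z"
  show "\<exists>qs. half_delete_move ps qs \<and> uniform qs" if "\<not> uniform ps"
    using pos that by (rule move_into_uniform)
  assume move: "half_delete_move ps qs"
  show "\<forall>z\<in>set qs. 0 < z" using move pos by (rule half_delete_move_pos)
  show "sum_list qs < sum_list ps" using move pos by (rule half_delete_move_sum_less)
  show "\<not> uniform qs" if "uniform ps" using move that by (rule move_from_uniform)
qed

theorem theorem4p2:
  fixes n :: nat and zs :: "nat list"
  assumes "n \<ge> 2" and "length zs = n" and "\<forall>z\<in>set zs. 0 < z"
  shows "(even n \<longrightarrow>
            (P_position half_delete_move zs \<longleftrightarrow> (\<forall>i<n. multiplicity 2 (zs ! i) = 0))) \<and>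
         (odd n \<longrightarrow>
            (P_position half_delete_move zs \<longleftrightarrow>
               (\<forall>i<n. \<forall>j<n. multiplicity 2 (zs ! i) = multiplicity 2 (zs ! j))))"
proof -
  have "0 < n" using assms(1) by simp
  have "P_position half_delete_move zs \<longleftrightarrow>
      (\<exists>m. (even n \<longrightarrow> m = 0) \<and> (\<forall>i<n. multiplicity 2 (zs ! i) = m))"
    using P_position_iff_uniform[OF assms(3)] assms(2)
    by (simp add: uniform_def all_set_conv_all_nth)
  \<comment> \<open>For odd \<open>n\<close> the common value \<open>m\<close> is the valuation at
    an existing index such as \<open>0\<close>.\<close>
  then show ?thesis using \<open>0 < n\<close> by metis
qed

end
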